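(* Let $\nu,n,a\in\mathbb R$ satisfy $\nu+n>-1$ and $a+n>-1$. Let $0<\gamma<1$ and $\gamma<\theta<1$. Then for all $x>0$, $$\int_0^x e^{-\gamma t}\,t^a\,\frac{I_{\nu+n}(t)}{t^\nu}\,dt\le M_{\nu+n,a+n,\gamma}(\theta)\,e^{-\gamma x}\,x^a\,\frac{I_{\nu+n+1}(x)}{x^\nu}.$$ If $a+n\ge0$, then $$M_{\nu+n,a+n,\gamma}(\theta)=\max\left\{K_{\nu+n,a+n}\exp\left(\frac{2\gamma(\nu+n+2)\theta}{1-\theta}\right),\ \frac{\nu+n+1+\theta}{(\nu+n+2)\theta(\theta-\gamma)}\right\},$$ where $K_{\nu+n,a+n}=\max\left\{1,\frac{2(\nu+n+1)}{a+n+1}\right\}$.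
   Context: $I_\alpha(x)=\sum_{k=0}^{\infty}\frac{(x/2)^{2k+\alpha}}{k!\,\Gamma(k+\alpha+1)}$, $x>0$, is the modified Bessel function of the first kind. For $\mu>-1$, $q>-1$, $0<\gamma<\theta<1$: $K_{\mu,q}=\max\{1,\frac{2(\mu+1)}{q+1}\}$; $X_{\mu,q}(\theta)=\frac{2(\mu+2)\theta}{1-\theta}$ if $q\ge0$, and if $-1<q<0$, $$X_{\mu,q}(\theta)=\max\left\{\frac{2(\mu+2)\theta}{1-\theta},\ \frac{(2\mu+2)\theta-q+\sqrt{\{(2\mu+2)\theta-q\}^2-4(1-\theta)q(2\mu+2)}}{2(1-\theta)}\right\};$$ $\beta_{\mu,q}(\theta)=\frac{X_{\mu,q}(\theta)}{X_{\mu,q}(\theta)+2\mu+2}$; and $M_{\mu,q,\gamma}(\theta)=\max\left\{K_{\mu,q}\exp(\gamma X_{\mu,q}(\theta)),\ \frac{1}{\beta_{\mu,q}(\theta)(\theta-\gamma)}\right\}$. *)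

theory Defs
  imports "HOL-Analysis.Analysis"
begin

text \<open>
  Modified Bessel function of the first kind; meant for \<open>x > 0\<close> (\<open>powr\<close> vanishes at base 0)
  and order \<open>\<alpha> > -1\<close>, where every Gamma argument is positive.
\<close>

definition bessel_I :: "real \<Rightarrow> real \<Rightarrow> real" where
  "bessel_I \<alpha> x =
     (\<Sum>k. (x / 2) powr (2 * real k + \<alpha>) / (fact k * Gamma (real k + \<alpha> + 1)))"

definition K_const :: "real \<Rightarrow> real \<Rightarrow> real" where
  "K_const \<mu> q = max 1 (2 * (\<mu> + 1) / (q + 1))"

text \<open>The constants below are meant for \<open>\<mu> > -1\<close>, \<open>q > -1\<close> and \<open>0 < \<gamma> < \<theta> < 1\<close>.\<close>

definition X_const :: "real \<Rightarrow> real \<Rightarrow> real \<Rightarrow> real" where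
  "X_const \<mu> q \<theta> =
     (if q \<ge> 0 then 2 * (\<mu> + 2) * \<theta> / (1 - \<theta>)
      else max (2 * (\<mu> + 2) * \<theta> / (1 - \<theta>))
               (((2 * \<mu> + 2) * \<theta> - q
                  + sqrt (((2 * \<mu> + 2) * \<theta> - q)\<^sup>2 - 4 * (1 - \<theta>) * q * (2 * \<mu> + 2)))
                / (2 * (1 - \<theta>))))"

definition \<beta>_const :: "real \<Rightarrow> real \<Rightarrow> real \<Rightarrow> real" where
  "\<beta>_const \<mu> q \<theta> = X_const \<mu> q \<theta> / (X_const \<mu> q \<theta> + 2 * \<mu> + 2)"

definition M_const :: "real \<Rightarrow> real \<Rightarrow> real \<Rightarrow> real \<Rightarrow> real" where
  "M_const \<mu> q \<gamma> \<theta> =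
     max (K_const \<mu> q * exp (\<gamma> * X_const \<mu> q \<theta>))
         (1 / (\<beta>_const \<mu> q \<theta> * (\<theta> - \<gamma>)))"

end

theory Submission
  imports Defs
begin

text \<open>
  Write \<open>\<mu> = \<nu> + n\<close>, \<open>q = a + n\<close> and \<open>p = a - \<nu> = q - \<mu>\<close>. The integrand is then
  \<open>f t = exp (- \<gamma> t) t\<^sup>p I\<^sub>\<mu>(t)\<close>, and the right-hand side is a multiple of
  \<open>G x = exp (- \<gamma> x) x\<^sup>p I\<^sub>\<mu>\<^sub>+\<^sub>1(x)\<close>, which behaves like \<open>x powr (q + 1)\<close> at \<open>0\<close> and so tends
  to \<open>0\<close> there. The inequality comes from comparing \<open>f\<close> with \<open>G'\<close> pointwise and integrating.
  The differentiation formula for \<open>I\<^sub>\<mu>\<^sub>+\<^sub>1\<close> gives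
  \<open>G'(t) = exp (- \<gamma> t) t\<^sup>p (I\<^sub>\<mu>\<^sub>+\<^sub>2(t) + ((q + 1) / t) I\<^sub>\<mu>\<^sub>+\<^sub>1(t) - \<gamma> I\<^sub>\<mu>\<^sub>+\<^sub>1(t))\<close>,
  while the three-term recurrence reads
  \<open>I\<^sub>\<mu>(t) = I\<^sub>\<mu>\<^sub>+\<^sub>2(t) + (2 (\<mu> + 1) / t) I\<^sub>\<mu>\<^sub>+\<^sub>1(t)\<close>.

  Up to \<open>X = X_const \<mu> q \<theta>\<close>, the exponential weight is dropped at the cost of a factor
  \<open>exp (\<gamma> X)\<close>. For \<open>\<gamma> = 0\<close> the bracket in \<open>G'\<close> and the right-hand side of the recurrence
  combine the same two positive functions, and comparing coefficients gives \<open>f \<le> K G'\<close>,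
  where \<open>K = max 1 (2 (\<mu> + 1) / (q + 1))\<close>.

  Beyond \<open>X\<close>, the ratio bound \<open>I\<^sub>\<alpha>\<^sub>+\<^sub>1(t) / I\<^sub>\<alpha>(t) \<ge> t / (t + 2 \<alpha> + 2)\<close>
  (lemma \<open>bessel_I_ratio_lower\<close>) is used twice. With \<open>\<alpha> = \<mu> + 1\<close> it gives
  \<open>I\<^sub>\<mu>\<^sub>+\<^sub>2 \<ge> \<theta> I\<^sub>\<mu>\<^sub>+\<^sub>1\<close> because \<open>t \<ge> X \<ge> 2 (\<mu> + 2) \<theta> / (1 - \<theta>)\<close>, so the bracket in \<open>G'\<close> is at least
  \<open>(\<theta> - \<gamma>) I\<^sub>\<mu>\<^sub>+\<^sub>1\<close>. With \<open>\<alpha> = \<mu>\<close> it gives \<open>I\<^sub>\<mu>\<^sub>+\<^sub>1 \<ge> \<beta> I\<^sub>\<mu>\<close>, where \<open>\<beta> = X / (X + 2 \<mu> + 2)\<close>. Hence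
  \<open>f \<le> G' / (\<beta> (\<theta> - \<gamma>))\<close>. The two constants appear as the two entries of the maximum
  that defines \<open>M_const\<close>.

  The ratio bound itself reduces, through the recurrence, to the monotonicity
  \<open>I\<^sub>\<beta>\<^sub>+\<^sub>1 \<le> I\<^sub>\<beta>\<close> in the order, for \<open>\<beta> > 0\<close> (lemma \<open>bessel_I_order_decreasing\<close>).
\<close>

section \<open>Differentiation and recurrence for modified Bessel functions\<close>

definition bessel_coeff :: "real \<Rightarrow> nat \<Rightarrow> real" where
  "bessel_coeff \<alpha> k = 1 / (fact k * Gamma (real k + \<alpha> + 1))"

text \<open>
  The entire factor of \<open>I\<^sub>\<alpha>\<close>: one has \<open>I\<^sub>\<alpha>(x) = (x/2) powr \<alpha> * bessel_series \<alpha> ((x/2)\<^sup>2)\<close>. In terms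
  of hypergeometric functions it is \<open>\<^sub>0F\<^sub>1(; \<alpha> + 1; y) / \<Gamma>(\<alpha> + 1)\<close>.
\<close>

definition bessel_series :: "real \<Rightarrow> real \<Rightarrow> real" where
  "bessel_series \<alpha> y = (\<Sum>k. bessel_coeff \<alpha> k * y ^ k)"

lemma bessel_coeff_pos: "\<alpha> > -1 \<Longrightarrow> bessel_coeff \<alpha> k > 0"
  unfolding bessel_coeff_def by (intro divide_pos_pos mult_pos_pos Gamma_real_pos) auto

lemma Gamma_shift:
  assumes "\<alpha> > -1"
  shows "Gamma (real k + \<alpha> + 2) = (real k + \<alpha> + 1) * Gamma (real k + \<alpha> + 1)"
proof -
  have "real k + \<alpha> + 1 > 0" using assms by linarith
  then have "real k + \<alpha> + 1 \<notin> \<int>\<^sub>\<le>\<^sub>0" by (auto elim!: nonpos_Ints_cases)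
  from Gamma_plus1[OF this] show ?thesis by (simp add: add_ac)
qed

lemma bessel_coeff_Suc:
  assumes "\<alpha> > -1"
  shows "bessel_coeff \<alpha> (Suc k) = bessel_coeff \<alpha> k / ((real k + 1) * (real k + \<alpha> + 1))"
proof -
  have "Gamma (real (Suc k) + \<alpha> + 1) = (real k + \<alpha> + 1) * Gamma (real k + \<alpha> + 1)"
    using Gamma_shift[OF assms, of k] by (simp add: add_ac)
  then show ?thesis
    unfolding bessel_coeff_def by (simp add: mult_ac)
qed

lemma summable_bessel_series:
  assumes "\<alpha> > -1"
  shows "summable (\<lambda>k. bessel_coeff \<alpha> k * y ^ k)"
proof (rule summable_ratio_test)
  show "(1/2 :: real) < 1" by simp
next
  fix k :: nat
  assume "k \<ge> nat \<lceil>2 * \<bar>y\<bar> + 1\<rceil>"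
  then have k: "real k \<ge> 2 * \<bar>y\<bar> + 1" by linarith
  let ?d = "(real k + 1) * (real k + \<alpha> + 1)"
  have "(2 * \<bar>y\<bar>) * 1 \<le> ?d"
    by (intro mult_mono) (use k assms in linarith)+
  moreover have d: "?d > 0"
    by (intro mult_pos_pos) (use k assms in linarith)+
  ultimately have "\<bar>y\<bar> / ?d \<le> 1/2"
    by (simp add: pos_divide_le_eq)
  then have "(\<bar>y\<bar> / ?d) * (bessel_coeff \<alpha> k * \<bar>y\<bar> ^ k) \<le> 1/2 * (bessel_coeff \<alpha> k * \<bar>y\<bar> ^ k)"
    using bessel_coeff_pos[OF assms, of k] by (intro mult_right_mono) auto
  then show "norm (bessel_coeff \<alpha> (Suc k) * y ^ Suc k) \<le> 1/2 * norm (bessel_coeff \<alpha> k * y ^ k)"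
    using bessel_coeff_pos[OF assms, of k] d
    by (simp add: bessel_coeff_Suc[OF assms] abs_mult power_abs abs_divide mult_ac del: of_nat_Suc)
       (use assms in \<open>simp add: abs_if split: if_splits\<close>)
qed

lemma bessel_series_pos:
  assumes "\<alpha> > -1" "y \<ge> 0"
  shows "bessel_series \<alpha> y > 0"
  unfolding bessel_series_def
proof (rule suminf_pos2[where i = 0])
  show "summable (\<lambda>k. bessel_coeff \<alpha> k * y ^ k)" by (rule summable_bessel_series[OF assms(1)])
  show "0 \<le> bessel_coeff \<alpha> k * y ^ k" for k
    using bessel_coeff_pos[OF assms(1), of k] assms(2) by simp
  show "0 < bessel_coeff \<alpha> 0 * y ^ 0"
    using bessel_coeff_pos[OF assms(1)] by simp
qed

lemma has_derivative_bessel_series: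
  assumes "\<alpha> > -1"
  shows "(bessel_series \<alpha> has_real_derivative bessel_series (\<alpha> + 1) y) (at y)"
proof -
  have "diffs (bessel_coeff \<alpha>) = bessel_coeff (\<alpha> + 1)"
    by (auto simp: fun_eq_iff diffs_def bessel_coeff_def add_ac)
  with termdiffs_strong_converges_everywhere[OF summable_bessel_series[OF assms], of y]
  show ?thesis by (simp add: bessel_series_def[abs_def])
qed

text \<open>
  Coefficientwise this is \<open>\<Gamma>(k + \<alpha> + 2) = (k + \<alpha> + 1) \<Gamma>(k + \<alpha> + 1)\<close> with the factor
  \<open>k + \<alpha> + 1\<close> split into \<open>\<alpha> + 1\<close> and \<open>k\<close>; the second part lowers \<open>k!\<close> to \<open>(k - 1)!\<close> and so
  shifts the series by one power.
\<close>

lemma bessel_series_recurrence: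
  assumes "\<alpha> > -1"
  shows "bessel_series \<alpha> y = (\<alpha> + 1) * bessel_series (\<alpha> + 1) y + y * bessel_series (\<alpha> + 2) y"
proof -
  let ?d = "\<lambda>k. real k * bessel_coeff (\<alpha> + 1) k * y ^ k"
  have "(\<lambda>k. bessel_coeff (\<alpha> + 2) k * y ^ k) sums bessel_series (\<alpha> + 2) y"
    unfolding bessel_series_def using assms by (intro summable_sums summable_bessel_series) auto
  from sums_mult[OF this, of y]
  have "(\<lambda>k. ?d (Suc k)) sums (y * bessel_series (\<alpha> + 2) y)"
    by (rule sums_cong[THEN iffD1, rotated]) (simp add: bessel_coeff_def add_ac)
  then have "?d sums (y * bessel_series (\<alpha> + 2) y)"
    by (subst (asm) sums_Suc_iff) simp
  moreover have "(\<lambda>k. (\<alpha> + 1) * (bessel_coeff (\<alpha> + 1) k * y ^ k)) sums ((\<alpha> + 1) * bessel_series (\<alpha> + 1) y)"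
    unfolding bessel_series_def using assms
    by (intro sums_mult summable_sums summable_bessel_series) auto
  ultimately have "(\<lambda>k. (\<alpha> + 1) * (bessel_coeff (\<alpha> + 1) k * y ^ k) + ?d k) sums
      ((\<alpha> + 1) * bessel_series (\<alpha> + 1) y + y * bessel_series (\<alpha> + 2) y)"
    by (rule sums_add[rotated])
  moreover have "(\<alpha> + 1) * (bessel_coeff (\<alpha> + 1) k * y ^ k) + ?d k = bessel_coeff \<alpha> k * y ^ k" for k
  proof -
    have "real k + \<alpha> + 1 > 0" using assms by linarith
    then have "(real k + \<alpha> + 1) * bessel_coeff (\<alpha> + 1) k = bessel_coeff \<alpha> k"
      using Gamma_shift[OF assms, of k] by (simp add: bessel_coeff_def add_ac)
    moreover have "(\<alpha> + 1) * (bessel_coeff (\<alpha> + 1) k * y ^ k) + ?d k =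
        ((real k + \<alpha> + 1) * bessel_coeff (\<alpha> + 1) k) * y ^ k"
      by (simp add: algebra_simps)
    ultimately show ?thesis by simp
  qed
  ultimately show ?thesis
    by (simp add: bessel_series_def sums_iff)
qed

lemma bessel_I_eq_series:
  assumes "\<alpha> > -1" "x > 0"
  shows "bessel_I \<alpha> x = (x / 2) powr \<alpha> * bessel_series \<alpha> ((x / 2)\<^sup>2)"
proof -
  have "(x / 2) powr (2 * real k + \<alpha>) = (x / 2) powr \<alpha> * ((x / 2)\<^sup>2) ^ k" for k
  proof -
    have "(x / 2) powr (2 * real k) = ((x / 2)\<^sup>2) ^ k"
      using assms powr_realpow[of "x / 2" "2 * k"] by (simp add: power_mult)
    then show ?thesis by (simp add: powr_add)
  qed
  then have "bessel_I \<alpha> x = (\<Sum>k. (x / 2) powr \<alpha> * (bessel_coeff \<alpha> k * ((x / 2)\<^sup>2) ^ k))"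
    by (simp add: bessel_I_def bessel_coeff_def)
  also have "\<dots> = (x / 2) powr \<alpha> * bessel_series \<alpha> ((x / 2)\<^sup>2)"
    unfolding bessel_series_def by (rule suminf_mult[OF summable_bessel_series[OF assms(1)]])
  finally show ?thesis .
qed

lemma bessel_I_pos: "\<alpha> > -1 \<Longrightarrow> x > 0 \<Longrightarrow> bessel_I \<alpha> x > 0"
  by (simp add: bessel_I_eq_series bessel_series_pos)

lemma bessel_I_recurrence:
  assumes "\<alpha> > -1" "x > 0"
  shows "bessel_I \<alpha> x = bessel_I (\<alpha> + 2) x + 2 * (\<alpha> + 1) / x * bessel_I (\<alpha> + 1) x"
proof -
  have pow: "(x / 2) powr (\<alpha> + 2) = (x / 2) powr \<alpha> * (x / 2)\<^sup>2"
    "(x / 2) powr (\<alpha> + 1) = (x / 2) powr \<alpha> * (x / 2)"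
    using assms by (simp_all only: powr_add) simp_all
  have "bessel_I (\<alpha> + 2) x = (x / 2) powr \<alpha> * ((x / 2)\<^sup>2 * bessel_series (\<alpha> + 2) ((x / 2)\<^sup>2))"
    using assms by (simp only: bessel_I_eq_series pow mult.assoc)
  moreover have "bessel_I (\<alpha> + 1) x = (x / 2) powr \<alpha> * (x / 2) * bessel_series (\<alpha> + 1) ((x / 2)\<^sup>2)"
    using assms by (simp only: bessel_I_eq_series pow)
  then have "2 * (\<alpha> + 1) / x * bessel_I (\<alpha> + 1) x =
      (x / 2) powr \<alpha> * ((\<alpha> + 1) * bessel_series (\<alpha> + 1) ((x / 2)\<^sup>2))"
    using assms by (simp add: field_simps)
  ultimately show ?thesis
    using bessel_series_recurrence[OF assms(1), of "(x / 2)\<^sup>2"]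
    by (simp only: bessel_I_eq_series[OF assms] distrib_left)
qed

lemma has_derivative_bessel_I:
  assumes "\<alpha> > -1" "x > 0"
  shows "(bessel_I \<alpha> has_real_derivative bessel_I (\<alpha> + 1) x + \<alpha> / x * bessel_I \<alpha> x) (at x)"
proof -
  have S: "((\<lambda>x. bessel_series \<alpha> ((x / 2)\<^sup>2)) has_real_derivative
      bessel_series (\<alpha> + 1) ((x / 2)\<^sup>2) * (x / 2)) (at x)"
    by (rule DERIV_chain2[OF has_derivative_bessel_series[OF assms(1)]])
       (auto intro!: derivative_eq_intros)
  have P: "((\<lambda>x. (x / 2) powr \<alpha>) has_real_derivative \<alpha> / x * (x / 2) powr \<alpha>) (at x)"
    using assms by (auto intro!: derivative_eq_intros simp: powr_diff field_simps)
  have "((\<lambda>x. (x / 2) powr \<alpha> * bessel_series \<alpha> ((x / 2)\<^sup>2)) has_real_derivative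
      bessel_I (\<alpha> + 1) x + \<alpha> / x * bessel_I \<alpha> x) (at x)"
    by (rule DERIV_cong[OF DERIV_mult[OF P S]])
       (use assms in \<open>simp add: bessel_I_eq_series powr_add mult_ac\<close>)
  then show ?thesis
    by (rule has_field_derivative_transform_within_open[where S = "{0<..}"])
       (use assms in \<open>auto simp: bessel_I_eq_series\<close>)
qed

lemma isCont_bessel_I: "\<alpha> > -1 \<Longrightarrow> x > 0 \<Longrightarrow> isCont (bessel_I \<alpha>) x"
  using has_derivative_bessel_I DERIV_isCont by blast

lemma tendsto_powr_bessel_I_0:
  assumes "\<alpha> > -1" "p + \<alpha> > 0"
  shows "((\<lambda>x. x powr p * bessel_I \<alpha> x) \<longlongrightarrow> 0) (at_right 0)"
proof -
  have "isCont (bessel_series \<alpha>) 0"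
    using has_derivative_bessel_series[OF assms(1)] DERIV_isCont by blast
  then have "((\<lambda>x. bessel_series \<alpha> ((x / 2)\<^sup>2)) \<longlongrightarrow> bessel_series \<alpha> 0) (at_right 0)"
    by (rule isCont_tendsto_compose) (auto intro!: tendsto_eq_intros)
  moreover have "((\<lambda>x::real. x powr (p + \<alpha>)) \<longlongrightarrow> 0) (at_right 0)"
    using assms by (auto intro!: tendsto_eq_intros eventually_at_rightI[of 0 1])
  ultimately have "((\<lambda>x. x powr (p + \<alpha>) * ((1/2) powr \<alpha> * bessel_series \<alpha> ((x / 2)\<^sup>2))) \<longlongrightarrow>
      0 * ((1/2) powr \<alpha> * bessel_series \<alpha> 0)) (at_right 0)"
    by (intro tendsto_intros)
  then have "((\<lambda>x. x powr (p + \<alpha>) * ((1/2) powr \<alpha> * bessel_series \<alpha> ((x / 2)\<^sup>2))) \<longlongrightarrow> 0)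
      (at_right 0)" by simp
  then show ?thesis
    by (rule Lim_transform_eventually)
       (use assms in \<open>auto intro!: eventually_at_rightI[of 0 1]
          simp: bessel_I_eq_series powr_add powr_divide field_simps\<close>)
qed

section \<open>Monotonicity in the order and a bound for ratios\<close>

text \<open>
  The difference \<open>D = I\<^sub>\<beta> - I\<^sub>\<beta>\<^sub>+\<^sub>1\<close> satisfies
  \<open>D' = - D + (\<beta> I\<^sub>\<beta> + (\<beta> + 1) I\<^sub>\<beta>\<^sub>+\<^sub>1) / x\<close>. Hence \<open>exp x * D x\<close> increases, and it starts
  from the limit \<open>0\<close> because \<open>\<beta> > 0\<close>.
\<close>

lemma bessel_I_order_decreasing:
  assumes "\<beta> > 0" "x > 0"
  shows "bessel_I (\<beta> + 1) x \<le> bessel_I \<beta> x"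
proof -
  let ?E = "\<lambda>x. exp x * (bessel_I \<beta> x - bessel_I (\<beta> + 1) x)"
  have deriv: "(?E has_real_derivative
      exp y * ((\<beta> * bessel_I \<beta> y + (\<beta> + 1) * bessel_I (\<beta> + 1) y) / y)) (at y)"
    if "y > 0" for y
  proof -
    have "(bessel_I (\<beta> + 1) has_real_derivative
        bessel_I \<beta> y - (\<beta> + 1) / y * bessel_I (\<beta> + 1) y) (at y)"
      by (rule DERIV_cong[OF has_derivative_bessel_I])
         (use assms that bessel_I_recurrence[of \<beta> y] in \<open>auto simp: add_ac field_simps\<close>)
    from DERIV_mult[OF DERIV_exp[of y]
        DERIV_diff[OF has_derivative_bessel_I[of \<beta> y] this]]
    show ?thesis
      by (rule DERIV_cong) (use assms that in \<open>auto simp: field_simps\<close>)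
  qed
  have mono: "?E y \<le> ?E x" if "0 < y" "y < x" for y
  proof (rule DERIV_nonneg_imp_nondecreasing[where f = ?E])
    fix z assume "y \<le> z" "z \<le> x"
    then have z: "z > 0" using that by linarith
    have "0 \<le> exp z * ((\<beta> * bessel_I \<beta> z + (\<beta> + 1) * bessel_I (\<beta> + 1) z) / z)"
      using assms z bessel_I_pos[of \<beta> z] bessel_I_pos[of "\<beta> + 1" z] by simp
    with deriv[OF z] show "\<exists>d. (?E has_real_derivative d) (at z) \<and> d \<ge> 0" by blast
  qed (use that in simp)
  have lim: "(bessel_I \<alpha> \<longlongrightarrow> 0) (at_right 0)" if "\<alpha> > 0" for \<alpha>
  proof (rule Lim_transform_eventually)
    show "((\<lambda>x. x powr 0 * bessel_I \<alpha> x) \<longlongrightarrow> 0) (at_right 0)"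
      using that by (intro tendsto_powr_bessel_I_0) auto
    show "\<forall>\<^sub>F x in at_right 0. x powr 0 * bessel_I \<alpha> x = bessel_I \<alpha> x"
      by (rule eventually_at_rightI[of 0 1]) auto
  qed
  have "(?E \<longlongrightarrow> exp 0 * (0 - 0)) (at_right 0)"
    using assms by (intro tendsto_intros lim) auto
  then have "(?E \<longlongrightarrow> 0) (at_right 0)" by simp
  then have "0 \<le> ?E x"
    by (rule tendsto_upperbound)
       (use assms mono in \<open>auto intro!: eventually_at_rightI[of 0 x]\<close>)
  then show ?thesis by (simp add: zero_le_mult_iff)
qed

text \<open>
  By the recurrence, the claim is equivalent to \<open>x * I\<^sub>\<alpha>\<^sub>+\<^sub>2 \<le> x * I\<^sub>\<alpha>\<^sub>+\<^sub>1\<close>.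
\<close>

lemma bessel_I_ratio_lower:
  assumes "\<alpha> > -1" "x > 0"
  shows "x / (x + 2 * \<alpha> + 2) * bessel_I \<alpha> x \<le> bessel_I (\<alpha> + 1) x"
proof -
  have "x * bessel_I \<alpha> x = x * bessel_I (\<alpha> + 2) x + 2 * (\<alpha> + 1) * bessel_I (\<alpha> + 1) x"
    using assms by (subst bessel_I_recurrence[OF assms]) (simp add: field_simps)
  also have "\<dots> \<le> x * bessel_I (\<alpha> + 1) x + 2 * (\<alpha> + 1) * bessel_I (\<alpha> + 1) x"
    using bessel_I_order_decreasing[of "\<alpha> + 1" x] assms by (simp add: add_ac)
  finally show ?thesis
    using assms by (simp add: field_simps)
qed

section \<open>Pointwise comparison of the integrand with a derivative\<close>

text \<open>
  The derivative is written through \<open>I\<^sub>\<mu>\<^sub>+\<^sub>2\<close> and \<open>I\<^sub>\<mu>\<^sub>+\<^sub>1 / t\<close>, the two functions that also make up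
  \<open>I\<^sub>\<mu>\<close> in the recurrence, so that it can be compared with \<open>I\<^sub>\<mu>\<close> coefficient by coefficient.
\<close>

lemma has_derivative_weighted_bessel_I:
  assumes "\<mu> > -1" "t > 0"
  shows "((\<lambda>t. exp (- \<gamma> * t) * (t powr p * bessel_I (\<mu> + 1) t)) has_real_derivative
    exp (- \<gamma> * t) * (t powr p *
      (bessel_I (\<mu> + 2) t + ((p + \<mu> + 1) / t - \<gamma>) * bessel_I (\<mu> + 1) t))) (at t)"
proof -
  have E: "((\<lambda>t. exp (- \<gamma> * t)) has_real_derivative - \<gamma> * exp (- \<gamma> * t)) (at t)"
    by (auto intro!: derivative_eq_intros)
  have P: "((\<lambda>t. t powr p) has_real_derivative p / t * t powr p) (at t)"
    using assms by (auto intro!: derivative_eq_intros simp: powr_diff field_simps)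
  have B: "(bessel_I (\<mu> + 1) has_real_derivative
      bessel_I (\<mu> + 2) t + (\<mu> + 1) / t * bessel_I (\<mu> + 1) t) (at t)"
    by (rule DERIV_cong[OF has_derivative_bessel_I]) (use assms in \<open>auto simp: add_ac\<close>)
  show ?thesis
    by (rule DERIV_cong[OF DERIV_mult[OF E DERIV_mult[OF P B]]])
       (use assms in \<open>simp add: field_simps\<close>)
qed

lemma K_const_ge: "K_const \<mu> q \<ge> 1" "q > -1 \<Longrightarrow> 2 * (\<mu> + 1) \<le> K_const \<mu> q * (q + 1)"
proof -
  show "K_const \<mu> q \<ge> 1" by (simp add: K_const_def)
  assume "q > -1"
  moreover have "2 * (\<mu> + 1) / (q + 1) \<le> K_const \<mu> q" by (simp add: K_const_def)
  ultimately show "2 * (\<mu> + 1) \<le> K_const \<mu> q * (q + 1)" by (simp add: pos_divide_le_eq)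
qed

lemma bessel_I_le_K_const:
  assumes "\<mu> > -1" "q > -1" "t > 0"
  shows "bessel_I \<mu> t \<le> K_const \<mu> q * (bessel_I (\<mu> + 2) t + (q + 1) / t * bessel_I (\<mu> + 1) t)"
proof -
  have "1 * bessel_I (\<mu> + 2) t \<le> K_const \<mu> q * bessel_I (\<mu> + 2) t"
    using K_const_ge(1) bessel_I_pos[of "\<mu> + 2" t] assms by (intro mult_right_mono) auto
  moreover have "2 * (\<mu> + 1) * (bessel_I (\<mu> + 1) t / t)
      \<le> K_const \<mu> q * (q + 1) * (bessel_I (\<mu> + 1) t / t)"
    using K_const_ge(2)[of q \<mu>] bessel_I_pos[of "\<mu> + 1" t] assms by (intro mult_right_mono) auto
  ultimately have "bessel_I (\<mu> + 2) t + 2 * (\<mu> + 1) / t * bessel_I (\<mu> + 1) t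
      \<le> K_const \<mu> q * bessel_I (\<mu> + 2) t + K_const \<mu> q * (q + 1) * (bessel_I (\<mu> + 1) t / t)"
    by simp
  also have "\<dots> = K_const \<mu> q * (bessel_I (\<mu> + 2) t + (q + 1) / t * bessel_I (\<mu> + 1) t)"
    by (simp add: distrib_left[of "K_const \<mu> q"] mult.assoc)
  finally show ?thesis unfolding bessel_I_recurrence[OF assms(1,3)] .
qed

lemma X_const_ge: "X_const \<mu> q \<theta> \<ge> 2 * (\<mu> + 2) * \<theta> / (1 - \<theta>)"
  by (simp add: X_const_def)

lemma X_const_pos:
  assumes "\<mu> > -1" "0 < \<theta>" "\<theta> < 1"
  shows "X_const \<mu> q \<theta> > 0"
proof -
  have "2 * (\<mu> + 2) * \<theta> / (1 - \<theta>) > 0" using assms by simp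
  with X_const_ge show ?thesis by (rule less_le_trans[rotated])
qed

lemma \<beta>_const_pos:
  assumes "\<mu> > -1" "0 < \<theta>" "\<theta> < 1"
  shows "\<beta>_const \<mu> q \<theta> > 0"
  using X_const_pos[OF assms, of q] assms by (simp add: \<beta>_const_def)

text \<open>
  The term \<open>(q + 1) / t\<close> is nonnegative and is discarded; what remains is bounded below by
  \<open>(\<theta> - \<gamma>) I\<^sub>\<mu>\<^sub>+\<^sub>1\<close>, and this in turn by a multiple of \<open>I\<^sub>\<mu>\<close>, through the ratio bound.
\<close>

lemma bessel_I_le_beyond_X_const:
  assumes "\<mu> > -1" "q > -1" "0 < \<gamma>" "\<gamma> < \<theta>" "\<theta> < 1" "X_const \<mu> q \<theta> \<le> t"
  shows "bessel_I \<mu> t \<le> 1 / (\<beta>_const \<mu> q \<theta> * (\<theta> - \<gamma>)) *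
    (bessel_I (\<mu> + 2) t + ((q + 1) / t - \<gamma>) * bessel_I (\<mu> + 1) t)"
proof -
  let ?X = "X_const \<mu> q \<theta>"
  have X: "?X > 0" and \<beta>: "\<beta>_const \<mu> q \<theta> > 0"
    using assms X_const_pos[of \<mu> \<theta> q] \<beta>_const_pos[of \<mu> \<theta> q] by auto
  with assms have t: "t > 0" by linarith
  have pos: "bessel_I \<mu> t > 0" "bessel_I (\<mu> + 1) t > 0"
    using assms t by (auto intro: bessel_I_pos)
  have "\<beta>_const \<mu> q \<theta> \<le> t / (t + 2 * \<mu> + 2)"
  proof -
    have "?X * (2 * \<mu> + 2) \<le> t * (2 * \<mu> + 2)" using assms by (intro mult_right_mono) auto
    then show ?thesis using X t assms by (simp add: \<beta>_const_def field_simps)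
  qed
  then have "\<beta>_const \<mu> q \<theta> * bessel_I \<mu> t \<le> t / (t + 2 * \<mu> + 2) * bessel_I \<mu> t"
    using pos by (intro mult_right_mono) auto
  also have "\<dots> \<le> bessel_I (\<mu> + 1) t"
    by (rule bessel_I_ratio_lower) (use assms t in auto)
  finally have "\<beta>_const \<mu> q \<theta> * (\<theta> - \<gamma>) * bessel_I \<mu> t \<le> (\<theta> - \<gamma>) * bessel_I (\<mu> + 1) t"
    using assms by (simp add: mult.assoc mult.left_commute[of _ "\<theta> - \<gamma>"])
  also have "\<dots> \<le> bessel_I (\<mu> + 2) t + ((q + 1) / t - \<gamma>) * bessel_I (\<mu> + 1) t"
  proof -
    have "2 * (\<mu> + 2) * \<theta> / (1 - \<theta>) \<le> t" using X_const_ge[of \<mu> \<theta> q] assms by linarith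
    then have "\<theta> \<le> t / (t + 2 * (\<mu> + 1) + 2)"
      using assms t by (simp add: field_simps)
    then have "\<theta> * bessel_I (\<mu> + 1) t \<le> t / (t + 2 * (\<mu> + 1) + 2) * bessel_I (\<mu> + 1) t"
      using pos by (intro mult_right_mono) auto
    also have "\<dots> \<le> bessel_I (\<mu> + 2) t"
      using bessel_I_ratio_lower[of "\<mu> + 1" t] assms t by (simp add: add_ac)
    finally have "\<theta> * bessel_I (\<mu> + 1) t \<le> bessel_I (\<mu> + 2) t" .
    moreover have "0 \<le> (q + 1) / t * bessel_I (\<mu> + 1) t" using assms t pos by simp
    ultimately show ?thesis by (simp add: left_diff_distrib)
  qed
  finally show ?thesis
    using \<beta> assms by (simp add: field_simps)
qed

section \<open>Integration of the comparison\<close>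

text \<open>
  Only one-sided limits of the antiderivative \<open>G\<close> enter, so that integrability near a singular
  endpoint is part of the conclusion.
\<close>

lemma set_integral_le_antiderivative:
  fixes f g G :: "real \<Rightarrow> real"
  assumes "a < b" "C > 0"
    and deriv: "\<And>t. a < t \<Longrightarrow> t < b \<Longrightarrow> (G has_real_derivative g t) (at t)"
    and contg: "\<And>t. a < t \<Longrightarrow> t < b \<Longrightarrow> isCont g t"
    and contf: "\<And>t. a < t \<Longrightarrow> t < b \<Longrightarrow> isCont f t"
    and nonneg: "\<And>t. a < t \<Longrightarrow> t < b \<Longrightarrow> 0 \<le> f t"
    and le: "\<And>t. a < t \<Longrightarrow> t < b \<Longrightarrow> f t \<le> C * g t"
    and A: "(G \<longlongrightarrow> A) (at_right a)" and B: "(G \<longlongrightarrow> B) (at_left b)"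
  shows "set_integrable lborel {a<..<b} f"
    and "(LBINT t:{a<..<b}. f t) \<le> C * (B - A)"
proof -
  have g: "0 \<le> g t" if "a < t" "t < b" for t
    using order_trans[OF nonneg le, OF that that] \<open>C > 0\<close> by (simp add: zero_le_mult_iff)
  note FTC = interval_integral_FTC_nonneg[of "ereal a" "ereal b" G g A B]
  have int_g: "set_integrable lborel {a<..<b} g" and val: "(LBINT t:{a<..<b}. g t) = B - A"
    using FTC assms g
    by (auto simp: ereal_tendsto_simps interval_lebesgue_integral_le_eq)
  have int_Cg: "set_integrable lborel {a<..<b} (\<lambda>t. C * g t)"
    using int_g by simp
  show int_f: "set_integrable lborel {a<..<b} f"
  proof (rule set_integrable_bound[OF int_Cg])
    have "continuous_on {a<..<b} f"
      using contf by (simp add: continuous_on_eq_continuous_at)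
    then show "set_borel_measurable lborel {a<..<b} f"
      using borel_measurable_continuous_on_indicator[of "{a<..<b}" f]
      by (simp add: set_borel_measurable_def)
    show "AE t in lborel. t \<in> {a<..<b} \<longrightarrow> norm (f t) \<le> norm (C * g t)"
    proof (rule AE_I2, rule impI)
      fix t assume "t \<in> {a<..<b}"
      then show "norm (f t) \<le> norm (C * g t)"
        using le[of t] nonneg[of t] by auto
    qed
  qed
  have "(LBINT t:{a<..<b}. f t) \<le> (LBINT t:{a<..<b}. C * g t)"
    using int_f int_Cg le by (intro set_integral_mono) auto
  also have "\<dots> = C * (B - A)" by (simp add: val)
  finally show "(LBINT t:{a<..<b}. f t) \<le> C * (B - A)" .
qed

lemma integral_bessel_I_upto:
  assumes "\<mu> > -1" "p + \<mu> > -1" "\<gamma> \<ge> 0" "x > 0"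
  defines "f \<equiv> \<lambda>t. exp (- \<gamma> * t) * (t powr p * bessel_I \<mu> t)"
  shows "set_integrable lborel {0<..<x} f"
    and "(LBINT t:{0<..<x}. f t) \<le> K_const \<mu> (p + \<mu>) * (x powr p * bessel_I (\<mu> + 1) x)"
proof -
  let ?K = "K_const \<mu> (p + \<mu>)"
  let ?G = "\<lambda>t. t powr p * bessel_I (\<mu> + 1) t"
  let ?g = "\<lambda>t. t powr p * (bessel_I (\<mu> + 2) t + (p + \<mu> + 1) / t * bessel_I (\<mu> + 1) t)"
  have K: "?K > 0" using K_const_ge(1)[of \<mu> "p + \<mu>"] by linarith
  have deriv: "(?G has_real_derivative ?g t) (at t)" if "t > 0" for t
    using has_derivative_weighted_bessel_I[OF assms(1) that, of 0 p] by simp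
  have le: "f t \<le> ?K * ?g t" if "t > 0" for t
  proof -
    have I: "bessel_I \<mu> t > 0" using assms(1) that by (rule bessel_I_pos)
    have "f t \<le> 1 * (t powr p * bessel_I \<mu> t)"
      unfolding f_def using assms(3) that I by (intro mult_right_mono) auto
    also have "\<dots> \<le> t powr p *
        (?K * (bessel_I (\<mu> + 2) t + (p + \<mu> + 1) / t * bessel_I (\<mu> + 1) t))"
      using bessel_I_le_K_const[OF assms(1,2) that] by (simp add: mult_left_mono)
    finally show ?thesis by (simp add: mult_ac)
  qed
  have "(?G \<longlongrightarrow> ?G x) (at_left x)"
    using DERIV_isCont[OF deriv[OF \<open>x > 0\<close>]] by (simp add: continuous_within_subset isCont_def filterlim_at_split)
  moreover have "(?G \<longlongrightarrow> 0) (at_right 0)"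
    using assms(1,2) by (intro tendsto_powr_bessel_I_0) auto
  moreover have "isCont f t" "0 \<le> f t" "isCont ?g t" if "t > 0" for t
    unfolding f_def using that assms(1) bessel_I_pos[of \<mu> t]
    by (auto intro!: continuous_intros isCont_bessel_I)
  ultimately have "set_integrable lborel {0<..<x} f \<and>
      (LBINT t:{0<..<x}. f t) \<le> ?K * (?G x - 0)"
    by (intro conjI set_integral_le_antiderivative[where G = ?G and g = ?g and C = ?K])
       (use \<open>x > 0\<close> K deriv le in auto)
  then show "set_integrable lborel {0<..<x} f" "(LBINT t:{0<..<x}. f t) \<le> ?K * ?G x"
    by auto
qed

lemma integral_bessel_I_beyond:
  fixes p \<mu> \<gamma> \<theta> x :: real
  defines "X \<equiv> X_const \<mu> (p + \<mu>) \<theta>" and "f \<equiv> \<lambda>t. exp (- \<gamma> * t) * (t powr p * bessel_I \<mu> t)"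
    and "G \<equiv> \<lambda>t. exp (- \<gamma> * t) * (t powr p * bessel_I (\<mu> + 1) t)"
  assumes "\<mu> > -1" "p + \<mu> > -1" "0 < \<gamma>" "\<gamma> < \<theta>" "\<theta> < 1" "X < x"
  shows "(LBINT t:{X<..<x}. f t) \<le> 1 / (\<beta>_const \<mu> (p + \<mu>) \<theta> * (\<theta> - \<gamma>)) * (G x - G X)"
proof -
  let ?C = "1 / (\<beta>_const \<mu> (p + \<mu>) \<theta> * (\<theta> - \<gamma>))"
  let ?g = "\<lambda>t. exp (- \<gamma> * t) * (t powr p *
      (bessel_I (\<mu> + 2) t + ((p + \<mu> + 1) / t - \<gamma>) * bessel_I (\<mu> + 1) t))"
  have X: "X > 0" and C: "?C > 0"
    using assms X_const_pos[of \<mu> \<theta> "p + \<mu>"] \<beta>_const_pos[of \<mu> \<theta> "p + \<mu>"] by auto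
  have deriv: "(G has_real_derivative ?g t) (at t)" if "t > 0" for t
    unfolding G_def by (rule has_derivative_weighted_bessel_I) (use assms that in auto)
  have contG: "(G \<longlongrightarrow> G t) (at_left t)" "(G \<longlongrightarrow> G t) (at_right t)" if "t > 0" for t
    using DERIV_isCont[OF deriv[OF that]] by (simp_all add: isCont_def filterlim_at_split)
  have le: "f t \<le> ?C * ?g t" if "X < t" for t
  proof -
    have "exp (- \<gamma> * t) * (t powr p * bessel_I \<mu> t) \<le> exp (- \<gamma> * t) * (t powr p *
        (?C * (bessel_I (\<mu> + 2) t + ((p + \<mu> + 1) / t - \<gamma>) * bessel_I (\<mu> + 1) t)))"
      using bessel_I_le_beyond_X_const[of \<mu> "p + \<mu>" \<gamma> \<theta> t] assms that
      by (intro mult_left_mono) auto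
    then show ?thesis by (simp add: f_def mult_ac)
  qed
  have "isCont f t" "0 \<le> f t" "isCont ?g t" if "t > 0" for t
    unfolding f_def using that \<open>\<mu> > -1\<close> bessel_I_pos[of \<mu> t]
    by (auto intro!: continuous_intros isCont_bessel_I)
  then show ?thesis
    by (intro set_integral_le_antiderivative(2)[where G = G and g = ?g])
       (use X C deriv le contG \<open>X < x\<close> in auto)
qed

text \<open>
  For \<open>x\<close> beyond \<open>X\<close>, the estimate on \<open>(0, X)\<close> contributes \<open>M G(X)\<close> and the one on \<open>(X, x)\<close>
  contributes at most \<open>M (G(x) - G(X))\<close>, so that the sum telescopes.
\<close>

lemma integral_bessel_I_le:
  fixes p \<mu> \<gamma> \<theta> x :: real
  assumes "\<mu> > -1" "p + \<mu> > -1" "0 < \<gamma>" "\<gamma> < \<theta>" "\<theta> < 1" "x > 0"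
  defines "f \<equiv> \<lambda>t. exp (- \<gamma> * t) * (t powr p * bessel_I \<mu> t)"
  shows "(LBINT t:{0<..<x}. f t) \<le>
    M_const \<mu> (p + \<mu>) \<gamma> \<theta> * (exp (- \<gamma> * x) * (x powr p * bessel_I (\<mu> + 1) x))"
proof -
  define G where "G t = exp (- \<gamma> * t) * (t powr p * bessel_I (\<mu> + 1) t)" for t
  let ?X = "X_const \<mu> (p + \<mu>) \<theta>" and ?K = "K_const \<mu> (p + \<mu>)"
    and ?C = "1 / (\<beta>_const \<mu> (p + \<mu>) \<theta> * (\<theta> - \<gamma>))" and ?M = "M_const \<mu> (p + \<mu>) \<gamma> \<theta>"
  have M: "?K * exp (\<gamma> * ?X) \<le> ?M" "?C \<le> ?M" by (simp_all add: M_const_def)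
  have X: "?X > 0" using assms by (intro X_const_pos) auto
  have G: "G t > 0" if "t > 0" for t
    using assms that bessel_I_pos[of "\<mu> + 1" t] by (simp add: G_def)
  have below: "(LBINT t:{0<..<y}. f t) \<le> ?M * G y" if "0 < y" "y \<le> ?X" for y
  proof -
    have "(LBINT t:{0<..<y}. f t) \<le> ?K * (y powr p * bessel_I (\<mu> + 1) y)"
      unfolding f_def using assms that by (intro integral_bessel_I_upto) auto
    also have "\<dots> = ?K * exp (\<gamma> * y) * G y"
      by (simp add: G_def exp_minus field_simps)
    also have "\<dots> \<le> ?K * exp (\<gamma> * ?X) * G y"
      using K_const_ge(1)[of \<mu> "p + \<mu>"] assms G[OF that(1)] that
      by (intro mult_right_mono mult_left_mono) auto
    also have "\<dots> \<le> ?M * G y"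
      using M(1) G[OF that(1)] by (intro mult_right_mono) auto
    finally show ?thesis .
  qed
  have "(LBINT t:{0<..<x}. f t) \<le> ?M * G x"
  proof (cases "x \<le> ?X")
    case True
    with below \<open>x > 0\<close> show ?thesis by blast
  next
    case False
    have "set_integrable lborel {0<..<x} f"
      unfolding f_def using assms by (intro integral_bessel_I_upto) auto
    then have "(LBINT t=0..?X. f t) + (LBINT t=?X..x. f t) = (LBINT t=0..x. f t)"
      using X False \<open>x > 0\<close>
      by (intro interval_integral_sum)
         (auto simp: interval_lebesgue_integrable_def min_def max_def zero_ereal_def)
    then have "(LBINT t:{0<..<x}. f t) = (LBINT t:{0<..<?X}. f t) + (LBINT t:{?X<..<x}. f t)"
      using X False \<open>x > 0\<close> by (simp add: interval_lebesgue_integral_le_eq zero_ereal_def)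
    also have "\<dots> \<le> ?M * G ?X + ?C * (G x - G ?X)"
      using integral_bessel_I_beyond[of \<mu> p \<gamma> \<theta> x] assms False below[OF X]
      unfolding f_def G_def by (intro add_mono) auto
    also have "\<dots> \<le> ?M * G x"
    proof -
      \<comment> \<open>Enlarging the constant from \<open>?C\<close> to \<open>?M\<close> requires \<open>G ?X \<le> G x\<close>, which the comparison
        itself provides because \<open>f\<close> is nonnegative.\<close>
      have "0 \<le> (LBINT t:{?X<..<x}. f t)"
        unfolding set_lebesgue_integral_def f_def using X assms(1) bessel_I_pos[of \<mu>]
        by (intro Bochner_Integration.integral_nonneg)
           (auto simp: indicator_def intro!: mult_nonneg_nonneg less_imp_le)
      also have "\<dots> \<le> ?C * (G x - G ?X)"
        using integral_bessel_I_beyond[of \<mu> p \<gamma> \<theta> x] assms False unfolding f_def G_def by auto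
      finally have "0 \<le> ?C * (G x - G ?X)" .
      moreover have "?C > 0" using \<beta>_const_pos[of \<mu> \<theta> "p + \<mu>"] assms by simp
      ultimately have "0 \<le> G x - G ?X" by (metis not_le mult_pos_neg)
      then have "?C * (G x - G ?X) \<le> ?M * (G x - G ?X)"
        using M(2) by (intro mult_right_mono) auto
      then show ?thesis by (simp add: algebra_simps)
    qed
    finally show ?thesis .
  qed
  then show ?thesis by (simp add: G_def)
qed

lemma M_const_nonneg_order:
  assumes "\<mu> > -1" "q \<ge> 0" "0 < \<theta>" "\<theta> < 1"
  shows "M_const \<mu> q \<gamma> \<theta> =
    max (max 1 (2 * (\<mu> + 1) / (q + 1)) * exp (2 * \<gamma> * (\<mu> + 2) * \<theta> / (1 - \<theta>)))
        ((\<mu> + 1 + \<theta>) / ((\<mu> + 2) * \<theta> * (\<theta> - \<gamma>)))"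
proof -
  have X: "X_const \<mu> q \<theta> = 2 * (\<mu> + 2) * \<theta> / (1 - \<theta>)"
    using assms by (simp add: X_const_def)
  have "X_const \<mu> q \<theta> + 2 * \<mu> + 2 = 2 * (\<mu> + 1 + \<theta>) / (1 - \<theta>)"
    using assms by (simp add: X field_simps)
  then have "\<beta>_const \<mu> q \<theta> = (\<mu> + 2) * \<theta> / (\<mu> + 1 + \<theta>)"
    using assms by (simp add: \<beta>_const_def X divide_simps) (simp add: algebra_simps)
  then show ?thesis
    by (simp add: M_const_def K_const_def X mult_ac)
qed

theorem theorem5p1:
  fixes \<nu> n a \<gamma> \<theta> :: real
  assumes "\<nu> + n > -1" and "a + n > -1"
    and "0 < \<gamma>" and "\<gamma> < 1" and "\<gamma> < \<theta>" and "\<theta> < 1"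
  shows "(\<forall>x>0.
            set_integrable lborel {0<..<x}
              (\<lambda>t. exp (- \<gamma> * t) * t powr a * (bessel_I (\<nu> + n) t / t powr \<nu>)) \<and>
            (LBINT t:{0<..<x}. exp (- \<gamma> * t) * t powr a * (bessel_I (\<nu> + n) t / t powr \<nu>))
              \<le> M_const (\<nu> + n) (a + n) \<gamma> \<theta> * exp (- \<gamma> * x) * x powr a
                  * (bessel_I (\<nu> + n + 1) x / x powr \<nu>)) \<and>
         (a + n \<ge> 0 \<longrightarrow>
            M_const (\<nu> + n) (a + n) \<gamma> \<theta> =
              max (max 1 (2 * (\<nu> + n + 1) / (a + n + 1))
                     * exp (2 * \<gamma> * (\<nu> + n + 2) * \<theta> / (1 - \<theta>)))
                  ((\<nu> + n + 1 + \<theta>) / ((\<nu> + n + 2) * \<theta> * (\<theta> - \<gamma>))))"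
proof (intro conjI allI impI)
  have integrand: "exp (- \<gamma> * t) * t powr a * (bessel_I \<alpha> t / t powr \<nu>) =
      exp (- \<gamma> * t) * (t powr (a - \<nu>) * bessel_I \<alpha> t)" for t \<alpha>
    by (simp add: powr_diff)
  have q: "a - \<nu> + (\<nu> + n) = a + n" by simp
  fix x :: real
  assume x: "x > 0"
  show "set_integrable lborel {0<..<x}
      (\<lambda>t. exp (- \<gamma> * t) * t powr a * (bessel_I (\<nu> + n) t / t powr \<nu>))"
    unfolding integrand by (rule integral_bessel_I_upto(1)) (use assms x in auto)
  show "(LBINT t:{0<..<x}. exp (- \<gamma> * t) * t powr a * (bessel_I (\<nu> + n) t / t powr \<nu>))
      \<le> M_const (\<nu> + n) (a + n) \<gamma> \<theta> * exp (- \<gamma> * x) * x powr a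
          * (bessel_I (\<nu> + n + 1) x / x powr \<nu>)"
    using integral_bessel_I_le[of "\<nu> + n" "a - \<nu>" \<gamma> \<theta> x] assms x
    unfolding integrand q by (simp add: powr_diff mult.assoc)
next
  assume "a + n \<ge> 0"
  then show "M_const (\<nu> + n) (a + n) \<gamma> \<theta> =
      max (max 1 (2 * (\<nu> + n + 1) / (a + n + 1))
             * exp (2 * \<gamma> * (\<nu> + n + 2) * \<theta> / (1 - \<theta>)))
          ((\<nu> + n + 1 + \<theta>) / ((\<nu> + n + 2) * \<theta> * (\<theta> - \<gamma>)))"
    by (rule M_const_nonneg_order[rotated]) (use assms in auto)
qed

end
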